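(* Let $n>q\ge 4$, let $\mathbf{d}=(d_1,\dots,d_n)$ be a non-increasing sequence of positive integers with $d_i\ge 2$ for $i\le q$, $d_i=1$ for $i>q$, and $d_1+\dots+d_n=2(n-1)$, and let $\mathbf{w}=(\mu_1,\dots,\mu_n)$ be non-negative reals, indexed so that $d_i=d_j$, $i<j$ implies $\mu_i\ge\mu_j$, and monotone in $\mathbf{d}$. Suppose $\mu_{2i-1}=\mu_{2i}$ and $d_{2i-1}=d_{2i}$ for $i=1,\dots,\lfloor q/2\rfloor$, and $\mu_{q+2i-1}=\mu_{q+2i}$ for $i=1,\dots,\lfloor (n-q)/2\rfloor$. Then there exists $T\in\mathcal{WT}(\mathbf{w},\mathbf{d})$ with $VWWI(T)=UB(\mathbf{w},\mathbf{d})$, where $$UB(\mathbf{w},\mathbf{d}):=\mu\Big[\tfrac{q+1}{4}\mu+\sum_{i=1}^q\mu_i\Big]-\sum_{i=q+1}^n\mu_i^2-\sum_{k=1}^{\lceil q/2\rceil}2M_k\Big[kM_k+2\sum_{l=1}^{k-1}lM_l\Big],$$ with $\mu:=\sum_{i=1}^n\mu_i$; $D_0:=0$, $D_1:=d_1+d_2-2$, $D_k:=2+\sum_{i=1}^{2k}(d_i-2)$ for $2\le k\le\lfloor q/2\rfloor$; $M_k:=\frac12\big(\mu_{2k-1}+\mu_{2k}+\sum_{i=1+D_{k-1}}^{D_k}\mu_{q+i}\big)$ for $k=1,\dots,\lfloor q/2\rfloor$; and $M_{\lfloor q/2\rfloor+1}:=\frac12\big(\mu_q+\sum_{i=0}^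{d_q-3}\mu_{n-i}\big)$.
   Context: For a tree $T$, $d_T(v)$ is the degree of $v$ and $d_T(u,v)$ the distance. A vertex-weighted tree has weights $\mu_T(v)$ on vertices; $VWWI(T)=\frac12\sum_{u,v\in V(T)}\mu_T(u)\mu_T(v)d_T(u,v)$. $\mathcal{WT}(\mathbf{w},\mathbf{d})$ is the set of vertex-weighted trees whose vertices can be labeled $v_1,\dots,v_n$ with $d_T(v_i)=d_i$, $\mu_T(v_i)=\mu_i$. $\mathbf{w}$ is monotone in $\mathbf{d}$ if $d_i,d_j\ge2$ and $i<j$ imply $\mu_i\ge\mu_j$.
   Formalization: In UB the sum in the first bracket is taken over the pendant vertices, i=q+1,…,n, instead of i=1,…,q; as printed the claim fails for d=(2,2,2,2,1,1), w=(0,0,0,0,1,1), where the only tree has VWWI 5 but the printed UB is 1. *)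

theory Defs
  imports Complex_Main
begin

record 'a weighted_graph =
  verts :: "'a set"
  edges :: "'a set set"
  weight :: "'a \<Rightarrow> real"

definition simple_graph :: "('a, 'b) weighted_graph_scheme \<Rightarrow> bool" where
  "simple_graph G \<longleftrightarrow> finite (verts G) \<and>
     (\<forall>e \<in> edges G. \<exists>u v. u \<in> verts G \<and> v \<in> verts G \<and> u \<noteq> v \<and> e = {u, v})"

definition walk :: "('a, 'b) weighted_graph_scheme \<Rightarrow> 'a list \<Rightarrow> bool" where
  "walk G xs \<longleftrightarrow> xs \<noteq> [] \<and> set xs \<subseteq> verts G \<and>
     (\<forall>i. Suc i < length xs \<longrightarrow> {xs ! i, xs ! Suc i} \<in> edges G)"

definition walk_betw :: "('a, 'b) weighted_graph_scheme \<Rightarrow> 'a \<Rightarrow> 'a list \<Rightarrow> 'a \<Rightarrow> bool" where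
  "walk_betw G u xs v \<longleftrightarrow> walk G xs \<and> hd xs = u \<and> last xs = v"

definition connected_graph :: "('a, 'b) weighted_graph_scheme \<Rightarrow> bool" where
  "connected_graph G \<longleftrightarrow> verts G \<noteq> {} \<and>
     (\<forall>u \<in> verts G. \<forall>v \<in> verts G. \<exists>xs. walk_betw G u xs v)"

definition graph_cycle :: "('a, 'b) weighted_graph_scheme \<Rightarrow> 'a list \<Rightarrow> bool" where
  "graph_cycle G xs \<longleftrightarrow> walk G xs \<and> 3 \<le> length xs \<and> distinct xs \<and> {last xs, hd xs} \<in> edges G"

definition is_tree :: "('a, 'b) weighted_graph_scheme \<Rightarrow> bool" where
  "is_tree G \<longleftrightarrow> simple_graph G \<and> connected_graph G \<and> (\<nexists>xs. graph_cycle G xs)"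

definition degree :: "('a, 'b) weighted_graph_scheme \<Rightarrow> 'a \<Rightarrow> nat" where
  "degree G v = card {e \<in> edges G. v \<in> e}"

text \<open>A walk is given by its list of vertices, so its length is one less than that of the list.\<close>

definition graph_dist :: "('a, 'b) weighted_graph_scheme \<Rightarrow> 'a \<Rightarrow> 'a \<Rightarrow> nat" where
  "graph_dist G u v = (LEAST k. \<exists>xs. walk_betw G u xs v \<and> length xs = Suc k)"

definition VWWI :: "('a, 'b) weighted_graph_scheme \<Rightarrow> real" where
  "VWWI T = 1 / 2 * (\<Sum>u \<in> verts T. \<Sum>v \<in> verts T.
     weight T u * weight T v * real (graph_dist T u v))"

text \<open>
  Sequences \<open>\<mu>\<^sub>1, \<dots>, \<mu>\<^sub>n\<close> and \<open>d\<^sub>1, \<dots>, d\<^sub>n\<close> are functions on \<^typ>\<open>nat\<close>, of which only the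
  values on \<open>{1..n}\<close> matter.
\<close>

definition WT :: "nat \<Rightarrow> (nat \<Rightarrow> real) \<Rightarrow> (nat \<Rightarrow> nat) \<Rightarrow> 'a weighted_graph set" where
  "WT n \<mu> d = {T. is_tree T \<and> (\<exists>v. bij_betw v {1..n} (verts T) \<and>
     (\<forall>i \<in> {1..n}. degree T (v i) = d i \<and> weight T (v i) = \<mu> i))}"

definition monotone_in :: "nat \<Rightarrow> (nat \<Rightarrow> real) \<Rightarrow> (nat \<Rightarrow> nat) \<Rightarrow> bool" where
  "monotone_in n \<mu> d \<longleftrightarrow>
     (\<forall>i \<in> {1..n}. \<forall>j \<in> {1..n}. 2 \<le> d i \<and> 2 \<le> d j \<and> i < j \<longrightarrow> \<mu> i \<ge> \<mu> j)"

text \<open>The subtractions below are exact, because \<open>d\<^sub>i \<ge> 2\<close> for every index \<open>i \<le> q\<close>.\<close>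

definition D :: "(nat \<Rightarrow> nat) \<Rightarrow> nat \<Rightarrow> nat" where
  "D d k = (if k = 0 then 0
            else if k = 1 then d 1 + d 2 - 2
            else 2 + (\<Sum>i = 1..2 * k. d i - 2))"

text \<open>
  The range \<open>{..<d\<^sub>q - 2}\<close> is \<open>{0..d\<^sub>q - 3}\<close> read over the integers, i.e. empty for \<open>d\<^sub>q = 2\<close>.
  The second branch is used for \<open>k = \<lfloor>q/2\<rfloor> + 1\<close> only, with \<open>q\<close> odd.
\<close>

definition M :: "nat \<Rightarrow> nat \<Rightarrow> (nat \<Rightarrow> real) \<Rightarrow> (nat \<Rightarrow> nat) \<Rightarrow> nat \<Rightarrow> real" where
  "M n q \<mu> d k =
     (if k \<le> q div 2
      then 1 / 2 * (\<mu> (2 * k - 1) + \<mu> (2 * k) + (\<Sum>i = 1 + D d (k - 1)..D d k. \<mu> (q + i)))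
      else 1 / 2 * (\<mu> q + (\<Sum>i<d q - 2. \<mu> (n - i))))"

text \<open>
  The sum in the first bracket runs over the pendant vertices \<open>q + 1, \<dots>, n\<close>: together with
  \<open>- \<Sum>\<mu>\<^sub>i\<^sup>2\<close> it is the contribution \<open>\<Sum>\<mu>\<^sub>i (\<mu> - \<mu>\<^sub>i)\<close> of the pendant edges. The source prints
  \<open>\<Sum>\<^sub>i\<^sub>=\<^sub>1\<^sup>q \<mu>\<^sub>i\<close> there, which cannot be meant: for \<open>q = 4\<close>, \<open>n = 6\<close>, \<open>d = (2,2,2,2,1,1)\<close> and
  \<open>\<mu> = (0,0,0,0,1,1)\<close> the only tree is the path on six vertices, whose index is 5, but the
  printed expression is 1.
\<close>

definition UB :: "nat \<Rightarrow> nat \<Rightarrow> (nat \<Rightarrow> real) \<Rightarrow> (nat \<Rightarrow> nat) \<Rightarrow> real" where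
  "UB n q \<mu> d = (let \<mu>tot = (\<Sum>i = 1..n. \<mu> i) in
     \<mu>tot * ((real q + 1) / 4 * \<mu>tot + (\<Sum>i = q + 1..n. \<mu> i))
     - (\<Sum>i = q + 1..n. (\<mu> i)\<^sup>2)
     - (\<Sum>k = 1..nat \<lceil>real q / 2\<rceil>. 2 * M n q \<mu> d k *
          (real k * M n q \<mu> d k + 2 * (\<Sum>l = 1..<k. real l * M n q \<mu> d l))))"

end

theory Submission
  imports Defs
begin

text \<open>
  The extremal tree is a caterpillar with spine \<open>1, 3, 5, \<dots>, 6, 4, 2\<close>. Since weights and degrees
  come in pairs, the leaves can be distributed so that the total weight sitting at the \<open>k\<close>-th spine
  position from either end is \<open>M\<^sub>k\<close> (and \<open>2 M\<^sub>k\<close> at the centre of a spine of odd length). The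
  pendant edges contribute \<open>\<Sum> \<mu>\<^sub>i (\<mu> - \<mu>\<^sub>i)\<close>. On the spine, the two masses \<open>M\<^sub>k\<close> and the two
  masses \<open>M\<^sub>l\<close> have total mutual distance \<open>2 (q + 1) - 4 min k l\<close>, and the sum of
  \<open>M\<^sub>k M\<^sub>l min k l\<close> over all \<open>k, l\<close> is the last sum in \<open>UB\<close> up to a factor.
\<close>

section \<open>Distances and acyclicity\<close>

lemma walk_append_edge:
  assumes "walk_betw G u xs v'" "{v', v} \<in> edges G" "v \<in> verts G"
  shows "walk_betw G u (xs @ [v]) v"
proof -
  have ne: "xs \<noteq> []" and l: "last xs = v'" using assms by (auto simp: walk_betw_def walk_def)
  have "{(xs @ [v]) ! i, (xs @ [v]) ! Suc i} \<in> edges G" if i: "Suc i < length (xs @ [v])" for i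
  proof (cases "Suc i < length xs")
    case True
    then show ?thesis using assms by (auto simp: walk_betw_def walk_def nth_append)
  next
    case False
    with i have "i = length xs - 1" "Suc i = length xs" by auto
    then show ?thesis using l ne assms(2) by (auto simp: nth_append last_conv_nth)
  qed
  then show ?thesis using assms ne by (auto simp: walk_betw_def walk_def)
qed

text \<open>Following neighbours of smaller \<open>\<psi>\<close> from \<open>v\<close> must end at
  \<open>u\<close>, the only zero; reversed, this path is a walk with \<open>\<psi> v\<close>
  edges.\<close>

lemma walk_of_descent:
  assumes u: "u \<in> verts G" and zero: "\<And>x. \<psi> x = 0 \<Longrightarrow> x \<in> verts G \<Longrightarrow> x = u"
    and down: "\<And>v. v \<in> verts G \<Longrightarrow> v \<noteq> u \<Longrightarrow>
      \<exists>v' \<in> verts G. {v', v} \<in> edges G \<and> \<psi> v = Suc (\<psi> v')"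
    and v: "v \<in> verts G" and u0: "\<psi> u = (0 :: nat)"
  shows "\<exists>xs. walk_betw G u xs v \<and> length xs = Suc (\<psi> v)"
  using v
proof (induction "\<psi> v" arbitrary: v)
  case 0
  then have "v = u" using zero by metis
  then show ?case using u u0
    by (intro exI[of _ "[u]"]) (auto simp: walk_betw_def walk_def)
next
  case (Suc k)
  then have "v \<noteq> u" using u0 by auto
  then obtain v' where v': "v' \<in> verts G" "{v', v} \<in> edges G" "\<psi> v = Suc (\<psi> v')"
    using down Suc.prems by metis
  then obtain xs where "walk_betw G u xs v'" "length xs = Suc (\<psi> v')"
    using Suc by (metis nat.inject)
  then show ?case using walk_append_edge[OF _ v'(2) Suc.prems] v'(3)
    by (intro exI[of _ "xs @ [v]"]) auto
qed

text \<open>The bound opposite to \<open>walk_of_descent\<close>: along a walk,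
  \<open>\<psi>\<close> starts at 0 and gains at most one per edge.\<close>

lemma walk_lipschitz:
  assumes lip: "\<And>x y. {x, y} \<in> edges G \<Longrightarrow> \<psi> y \<le> Suc (\<psi> x)"
    and "walk_betw G u xs v" and "\<psi> u = (0 :: nat)"
  shows "Suc (\<psi> v) \<le> length xs"
proof -
  have ne: "xs \<noteq> []" and h: "hd xs = u" and l: "last xs = v" using assms by (auto simp: walk_betw_def walk_def)
  have "\<psi> (xs ! i) \<le> i" if "i < length xs" for i
    using that
  proof (induction i)
    case 0
    then show ?case using h ne assms(3) by (simp add: hd_conv_nth)
  next
    case (Suc i)
    then have "{xs ! i, xs ! Suc i} \<in> edges G" using assms(2) by (auto simp: walk_betw_def walk_def)
    from lip[OF this] Suc show ?case by simp
  qed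
  from this[of "length xs - 1"] l ne show ?thesis
    by (cases xs) (auto simp: last_conv_nth)
qed

text \<open>Descent supplies a walk with \<open>\<psi> v\<close> edges and the Lipschitz bound
  excludes shorter ones, so a distance formula needs checking only edge by edge. The bare existence
  of a walk is recorded for connectedness.\<close>

lemma graph_dist_eqI:
  assumes "u \<in> verts G" and "\<And>x. x \<in> verts G \<Longrightarrow> \<psi> x = 0 \<longleftrightarrow> x = u"
    and "\<And>x y. {x, y} \<in> edges G \<Longrightarrow> \<psi> y \<le> Suc (\<psi> x)"
    and "\<And>v. v \<in> verts G \<Longrightarrow> v \<noteq> u \<Longrightarrow>
      \<exists>v' \<in> verts G. {v', v} \<in> edges G \<and> \<psi> v = Suc (\<psi> v')"
    and "v \<in> verts G"
  shows "graph_dist G u v = \<psi> v" "\<exists>xs. walk_betw G u xs v"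
proof -
  have u0: "\<psi> u = 0" using assms(1,2) by blast
  have ex: "\<exists>xs. walk_betw G u xs v \<and> length xs = Suc (\<psi> v)"
    by (rule walk_of_descent) (use assms u0 in auto)
  then show "\<exists>xs. walk_betw G u xs v" by blast
  show "graph_dist G u v = \<psi> v"
    unfolding graph_dist_def
  proof (rule Least_equality)
    show "\<exists>xs. walk_betw G u xs v \<and> length xs = Suc (\<psi> v)" by (rule ex)
  next
    fix k assume "\<exists>xs. walk_betw G u xs v \<and> length xs = Suc k"
    then obtain xs where "walk_betw G u xs v" "length xs = Suc k" by blast
    with walk_lipschitz[of G \<psi>, OF assms(3) _ u0] show "\<psi> v \<le> k" by fastforce
  qed
qed

text \<open>A vertex of maximal rank on a cycle would have both of its cycle neighbours as parent.\<close>

lemma no_cycle_parent_graph: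
  fixes rank :: "'a \<Rightarrow> nat"
  assumes E: "edges G = (\<lambda>x. {x, f x}) ` X" and rank: "\<And>x. x \<in> X \<Longrightarrow> rank (f x) < rank x"
  shows "\<not> graph_cycle G xs"
proof
  assume C: "graph_cycle G xs"
  define L where "L = length xs"
  have L: "3 \<le> L" "distinct xs" and ne: "xs \<noteq> []"
    using C by (auto simp: graph_cycle_def L_def)
  \<comment> \<open>Every edge joins a vertex to a parent of strictly smaller rank, so the endpoint
    of larger rank is the child.\<close>
  have up: "y = f x" if "{x, y} \<in> edges G" "rank y \<le> rank x" for x y
  proof -
    from that(1) E obtain z where z: "z \<in> X" "{x, y} = {z, f z}" by auto
    then show ?thesis using rank[OF z(1)] that(2) by (auto simp: doubleton_eq_iff)
  qed
  have step: "{xs ! i, xs ! (Suc i mod L)} \<in> edges G" if "i < L" for i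
  proof (cases "Suc i < L")
    case True
    then show ?thesis using C by (auto simp: graph_cycle_def walk_def L_def)
  next
    case False
    then have "Suc i = L" using that by simp
    then have "xs ! i = last xs" "Suc i mod L = 0" using ne by (auto simp: last_conv_nth L_def dest: sym)
    then show ?thesis using C ne by (auto simp: graph_cycle_def hd_conv_nth)
  qed
  have "0 \<in> {..<L}" using L by simp
  then have "finite ((\<lambda>i. rank (xs ! i)) ` {..<L})" "(\<lambda>i. rank (xs ! i)) ` {..<L} \<noteq> {}" by blast+
  from Max_in[OF this] Max_ge[OF this(1)]
  obtain i where i: "i < L" "\<And>j. j < L \<Longrightarrow> rank (xs ! j) \<le> rank (xs ! i)"
    by fastforce
  \<comment> \<open>The cyclic successor and predecessor of \<open>i\<close>; they differ because
    the cycle has at least three vertices.\<close>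
  define a where "a = Suc i mod L"
  define b where "b = (if i = 0 then L - 1 else i - 1)"
  have ab: "a < L" "b < L" "Suc b mod L = i" using i(1) L by (auto simp: a_def b_def)
  have "a \<noteq> b" using i(1) L by (cases "Suc i = L") (auto simp: a_def b_def)
  moreover have "xs ! a = f (xs ! i)" using up[OF step[OF i(1)]] i(2) ab by (simp add: a_def)
  moreover have "xs ! b = f (xs ! i)" using up[of "xs ! i" "xs ! b"] step[OF ab(2)] i(2) ab
    by (simp add: insert_commute)
  ultimately show False using L(2) ab(1,2) by (metis L_def nth_eq_iff_index_eq)
qed

text \<open>The edges at \<open>v\<close> are its own parent edge and one for each child. Strictly
  decreasing rank excludes loops and vertices that are parents of each other, so no edge is counted
  twice.\<close>

lemma degree_parent_graph:
  fixes rank :: "'a \<Rightarrow> nat"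
  assumes E: "edges G = (\<lambda>x. {x, f x}) ` X" and fin: "finite X"
    and rank: "\<And>x. x \<in> X \<Longrightarrow> rank (f x) < rank x"
  shows "degree G v = (if v \<in> X then 1 else 0) + card {x \<in> X. f x = v}"
proof -
  have inj: "inj_on (\<lambda>x. {x, f x}) X"
  proof (rule inj_onI)
    fix x y assume "x \<in> X" "y \<in> X" "{x, f x} = {y, f y}"
    then show "x = y" using rank[of x] rank[of y] by (auto simp: doubleton_eq_iff)
  qed
  have "{e \<in> edges G. v \<in> e} = (\<lambda>x. {x, f x}) ` ({x \<in> X. x = v} \<union> {x \<in> X. f x = v})"
    using E by auto
  then have "degree G v = card ({x \<in> X. x = v} \<union> {x \<in> X. f x = v})"
    unfolding degree_def by (simp only: card_image inj_on_subset[OF inj] Un_least Collect_restrict)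
  also have "\<dots> = card {x \<in> X. x = v} + card {x \<in> X. f x = v}"
    using fin rank by (intro card_Un_disjoint) force+
  also have "{x \<in> X. x = v} = (if v \<in> X then {v} else {})" by auto
  finally show ?thesis by auto
qed

section \<open>Caterpillars\<close>

text \<open>
  The spine is the path \<open>1, 3, 5, \<dots>, 6, 4, 2\<close> on the vertices \<open>1, \<dots>, q\<close>. Rooted at its
  middle vertex \<open>q\<close>, the parent of the spine vertex \<open>x\<close> is \<open>min (x + 2) q\<close>.
\<close>

locale caterpillar =
  fixes n q :: nat and a :: "nat \<Rightarrow> nat" and \<mu> :: "nat \<Rightarrow> real"
  assumes q: "2 \<le> q" "q \<le> n" and a: "\<And>x. x \<in> {q + 1..n} \<Longrightarrow> a x \<in> {1..q}"
begin

definition parent :: "nat \<Rightarrow> nat" where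
  "parent x = (if x < q then min (x + 2) q else a x)"

definition tree :: "nat weighted_graph" where
  "tree = \<lparr>verts = {1..n}, edges = (\<lambda>x. {x, parent x}) ` ({1..n} - {q}), weight = \<mu>\<rparr>"

text \<open>The place on the spine counted from the end \<open>1\<close>: odd vertices fill it from
  the left, even ones from the right, so that \<open>2 * k - 1\<close> and \<open>2 * k\<close> are
  mirror images.\<close>

definition spine_pos :: "nat \<Rightarrow> nat" where
  "spine_pos x = (if odd x then (x + 1) div 2 else q + 1 - x div 2)"

definition pos :: "nat \<Rightarrow> nat" where
  "pos x = spine_pos (if x \<le> q then x else a x)"

definition height :: "nat \<Rightarrow> nat" where
  "height x = (if x \<le> q then 0 else 1)"

text \<open>The intended distance: down to the spine, along it, and up again. The case
  \<open>v = u\<close> is separate because the formula would give 2 for a leaf.\<close>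

definition hops :: "nat \<Rightarrow> nat \<Rightarrow> nat" where
  "hops u v = (if v = u then 0
     else (if pos u \<le> pos v then pos v - pos u else pos u - pos v) + height u + height v)"

section \<open>Edges and positions on the spine\<close>

lemma tree_simps [simp]: "verts tree = {1..n}" "weight tree = \<mu>"
  by (simp_all add: tree_def)

lemma edges_tree: "edges tree = (\<lambda>x. {x, parent x}) ` ({1..n} - {q})"
  by (simp add: tree_def)

lemma parent_in: "x \<in> {1..n} - {q} \<Longrightarrow> parent x \<in> {1..q}"
  using a[of x] q by (auto simp: parent_def)

text \<open>The rank is \<open>q - x\<close> on the spine, which is 0 at the root; leaves get
  \<open>q\<close>, more than any spine vertex.\<close>

lemma parent_rank: "x \<in> {1..n} - {q} \<Longrightarrow> (if parent x \<le> q then q - parent x else q) < (if x \<le> q then q - x else q)"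
  using a[of x] q by (auto simp: parent_def)

text \<open>Parents lie towards the middle. In the case \<open>x + 1 = q\<close> the two halves of
  the spine meet.\<close>

lemma spine_pos_parent:
  assumes "1 \<le> x" "x < q"
  shows "spine_pos (parent x) = (if odd x then spine_pos x + 1 else spine_pos x - 1)"
    and "1 \<le> spine_pos x" "spine_pos x \<le> q"
proof -
  consider "x + 2 \<le> q" | "x + 1 = q" using assms by linarith
  then show "spine_pos (parent x) = (if odd x then spine_pos x + 1 else spine_pos x - 1)"
    using assms by cases (auto simp: spine_pos_def parent_def elim!: oddE evenE)
  show "1 \<le> spine_pos x" "spine_pos x \<le> q"
    using assms by (auto simp: spine_pos_def elim!: oddE evenE)
qed

text \<open>Odd vertices have positions at most \<open>(q + 1) / 2\<close>, even ones at least
  \<open>q / 2 + 1\<close>.\<close>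

lemma spine_pos_inj: "x \<in> {1..q} \<Longrightarrow> y \<in> {1..q} \<Longrightarrow> spine_pos x = spine_pos y \<Longrightarrow> x = y"
  by (cases "odd x"; cases "odd y") (auto simp: spine_pos_def elim!: oddE evenE)

lemma edge_iff: "{x, y} \<in> edges tree \<longleftrightarrow>
    (x \<in> {1..n} - {q} \<and> y = parent x) \<or> (y \<in> {1..n} - {q} \<and> x = parent y)"
  unfolding edges_tree by (auto simp: doubleton_eq_iff)

lemma spine_neighbour_up:
  assumes "x \<in> {1..q}" "spine_pos x < q"
  shows "\<exists>y \<in> {1..q}. {y, x} \<in> edges tree \<and> spine_pos y = spine_pos x + 1"
proof -
  \<comment> \<open>On the odd half the next position belongs to the parent, on the even half to a
    child; an odd root crosses over to \<open>q - 1\<close>.\<close>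
  consider "odd x" "x < q" | "odd x" "x = q" | "even x" "2 < x"
    using assms by (cases "odd x"; cases "x = 2"; cases "x = q") (auto simp: spine_pos_def elim!: evenE)
  then show ?thesis
  proof cases
    case 1
    then show ?thesis using assms q spine_pos_parent[of x] parent_in[of x]
      by (intro bexI[of _ "parent x"]) (auto simp: edge_iff)
  next
    case 2
    with q assms have "3 \<le> q" by (cases "q = 2") auto
    with 2 show ?thesis using assms q
      by (intro bexI[of _ "q - 1"]) (auto simp: edge_iff parent_def spine_pos_def elim!: oddE)
  next
    case 3
    then show ?thesis using assms q
      by (intro bexI[of _ "x - 2"]) (auto simp: edge_iff parent_def spine_pos_def elim!: evenE)
  qed
qed

lemma spine_neighbour_down:
  assumes "x \<in> {1..q}" "1 < spine_pos x"
  shows "\<exists>y \<in> {1..q}. {y, x} \<in> edges tree \<and> spine_pos x = spine_pos y + 1"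
proof -
  consider "even x" "x < q" | "even x" "x = q" | "odd x" "2 < x"
    using assms by (cases "odd x"; cases "x = 1"; cases "x = q") (auto simp: spine_pos_def elim!: oddE)
  then show ?thesis
  proof cases
    case 1
    then show ?thesis using assms q spine_pos_parent[of x] parent_in[of x]
      by (intro bexI[of _ "parent x"]) (auto simp: edge_iff)
  next
    case 2
    then show ?thesis using assms q
      by (intro bexI[of _ "q - 1"]) (auto simp: edge_iff parent_def spine_pos_def elim!: evenE)
  next
    case 3
    then show ?thesis using assms q
      by (intro bexI[of _ "x - 2"]) (auto simp: edge_iff parent_def spine_pos_def elim!: oddE)
  qed
qed

section \<open>Distances in the caterpillar\<close>

lemma pos_bounds: "x \<in> {1..n} \<Longrightarrow> 1 \<le> pos x \<and> pos x \<le> q"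
  using a[of x] by (auto simp: pos_def spine_pos_def elim!: oddE evenE)

text \<open>Each edge changes either the position or the height, and by exactly one; hence
  \<open>hops\<close> changes by at most one along it.\<close>

lemma parent_pos_height:
  assumes "x \<in> {1..n} - {q}"
  shows "(height x = 0 \<and> height (parent x) = 0 \<and> (pos (parent x) = pos x + 1 \<or> pos x = pos (parent x) + 1))
    \<or> (height x = 1 \<and> height (parent x) = 0 \<and> pos (parent x) = pos x)"
proof (cases "x < q")
  case True
  have "pos (parent x) = spine_pos (parent x)" "pos x = spine_pos x" "parent x \<le> q"
    using parent_in[OF assms] True by (auto simp: pos_def)
  then show ?thesis using spine_pos_parent[of x] pos_bounds[of "parent x"] parent_in[OF assms] assms True
    by (auto simp: height_def)
next
  case False
  then show ?thesis using assms a[of x] by (auto simp: height_def pos_def parent_def)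
qed

lemma hops_lipschitz:
  assumes "{x, y} \<in> edges tree"
  shows "hops u y \<le> Suc (hops u x)"
proof -
  have "hops u (parent x) \<le> Suc (hops u x) \<and> hops u x \<le> Suc (hops u (parent x))"
    if "x \<in> {1..n} - {q}" for x
    using parent_pos_height[OF that] by (auto simp: hops_def)
  then show ?thesis using assms unfolding edge_iff by blast
qed

lemma hops_eq_0_iff:
  assumes "u \<in> {1..n}" "v \<in> {1..n}"
  shows "hops u v = 0 \<longleftrightarrow> v = u"
  using assms spine_pos_inj[of u v] by (auto simp: hops_def height_def pos_def le_less split: if_splits)

lemma hops_descent:
  assumes u: "u \<in> {1..n}" and v: "v \<in> {1..n}" and "v \<noteq> u"
  shows "\<exists>v' \<in> {1..n}. {v', v} \<in> edges tree \<and> hops u v = Suc (hops u v')"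
proof (cases "v \<le> q")
  case False
  then have x: "v \<in> {1..n} - {q}" using v by auto
  then have "parent v \<in> {1..n}" "{parent v, v} \<in> edges tree"
    using parent_in[OF x] q by (auto simp: edge_iff)
  moreover have "hops u v = Suc (hops u (parent v))"
    using parent_pos_height[OF x] False assms a[of v] a[of u] parent_in[OF x]
    by (auto simp: hops_def height_def pos_def parent_def split: if_splits dest: spine_pos_inj)
  ultimately show ?thesis by blast
next
  case vq: True
  have pv: "pos v = spine_pos v" and hv: "height v = 0" using vq by (auto simp: pos_def height_def)
  have py: "pos y = spine_pos y" "height y = 0" "y \<in> {1..n}" if "y \<in> {1..q}" for y
    using that q by (auto simp: pos_def height_def)
  consider "pos u = pos v" | "pos u < pos v" | "pos v < pos u" by linarith
  then show ?thesis
  proof cases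
    \<comment> \<open>A vertex other than \<open>v\<close> at the position of the spine vertex
      \<open>v\<close> is a leaf attached to \<open>v\<close>, so the step goes to \<open>u\<close>
      itself.\<close>
    case 1
    have uq: "q < u"
      using 1 spine_pos_inj[of u v] assms vq by (cases "u \<le> q") (auto simp: pos_def)
    then have "a u = v" using 1 spine_pos_inj[of "a u" v] a[of u] u v vq by (auto simp: pos_def)
    then have "{u, v} \<in> edges tree" using uq u by (auto simp: edge_iff parent_def)
    moreover have "hops u v = Suc (hops u u)" using 1 uq hv assms(3) by (auto simp: hops_def height_def)
    ultimately show ?thesis using u by blast
  next
    case 2
    then obtain y where y: "y \<in> {1..q}" "{y, v} \<in> edges tree" "spine_pos v = spine_pos y + 1"
      using spine_neighbour_down[of v] v vq pv pos_bounds[OF u] by auto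
    have "hops u v = Suc (hops u y)"
      using 2 py[OF y(1)] y(3) pv hv assms(3) by (auto simp: hops_def)
    then show ?thesis using y py by blast
  next
    case 3
    then obtain y where y: "y \<in> {1..q}" "{y, v} \<in> edges tree" "spine_pos y = spine_pos v + 1"
      using spine_neighbour_up[of v] v vq pv pos_bounds[OF u] by auto
    have "hops u v = Suc (hops u y)"
      using 3 py[OF y(1)] y(3) pv hv assms(3) by (auto simp: hops_def)
    then show ?thesis using y py by blast
  qed
qed

lemma tree_dist:
  assumes "u \<in> {1..n}" "v \<in> {1..n}"
  shows "graph_dist tree u v = hops u v" "\<exists>xs. walk_betw tree u xs v"
proof -
  show "graph_dist tree u v = hops u v"
    by (rule graph_dist_eqI) (use assms hops_eq_0_iff hops_lipschitz hops_descent in \<open>simp_all del: atLeastAtMost_iff\<close>)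
  show "\<exists>xs. walk_betw tree u xs v"
    by (rule graph_dist_eqI[where \<psi> = "hops u"])
      (use assms hops_eq_0_iff hops_lipschitz hops_descent in \<open>simp_all del: atLeastAtMost_iff\<close>)
qed

section \<open>Tree property, degrees and index of the caterpillar\<close>

lemma is_tree_tree: "is_tree tree"
proof -
  have "simple_graph tree"
    unfolding simple_graph_def
  proof (intro conjI ballI)
    fix e assume "e \<in> edges tree"
    then obtain x where x: "x \<in> {1..n} - {q}" "e = {x, parent x}" unfolding edges_tree by blast
    then have "parent x \<in> {1..n}" "x \<noteq> parent x"
      using parent_in[OF x(1)] parent_rank[OF x(1)] q by (auto split: if_splits)
    then show "\<exists>u v. u \<in> verts tree \<and> v \<in> verts tree \<and> u \<noteq> v \<and> e = {u, v}"
      using x by auto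
  qed simp
  moreover have "connected_graph tree"
    unfolding connected_graph_def using tree_dist(2) q by simp
  moreover have "\<not> graph_cycle tree xs" for xs
    by (rule no_cycle_parent_graph[of tree parent "{1..n} - {q}" "\<lambda>x. if x \<le> q then q - x else q", OF edges_tree parent_rank])
  ultimately show ?thesis by (auto simp: is_tree_def)
qed

lemma degree_tree:
  assumes "v \<in> {1..n}"
  shows "degree tree v = (if q < v then 1 else if v \<le> 2 \<and> 2 < q \<or> q = 2 then 1 else 2)
    + card {x \<in> {q + 1..n}. a x = v}"
proof -
  have s: "{x \<in> {1..n} - {q}. parent x = v} =
      {x \<in> {1..<q}. min (x + 2) q = v} \<union> {x \<in> {q + 1..n}. a x = v}"
    using q by (auto simp: parent_def)
  have "card {x \<in> {1..n} - {q}. parent x = v} =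
      card {x \<in> {1..<q}. min (x + 2) q = v} + card {x \<in> {q + 1..n}. a x = v}"
    unfolding s by (intro card_Un_disjoint) auto
  \<comment> \<open>The children within the spine. For \<open>q > 2\<close> the root has two but no
    parent edge, the ends 1 and 2 have none, and all others have one.\<close>
  moreover have "{x \<in> {1..<q}. min (x + 2) q = v} =
      (if v < q \<and> 3 \<le> v then {v - 2} else if v = q \<and> q \<noteq> 2 then {q - 2, q - 1}
       else if v = q then {1} else {})"
    using q by (auto simp: min_def split: if_splits)
  then have "card {x \<in> {1..<q}. min (x + 2) q = v} =
      (if v < q \<and> 3 \<le> v then 1 else if v = q \<and> q \<noteq> 2 then 2 else if v = q then 1 else 0)"
    using q by auto
  ultimately show ?thesis
    using degree_parent_graph[of tree parent "{1..n} - {q}" "\<lambda>x. if x \<le> q then q - x else q" v,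
        OF edges_tree _ parent_rank] assms q by auto
qed

text \<open>Away from the diagonal, \<open>hops\<close> is a position distance plus two heights. The
  height terms factor into leaf weight times total weight, and the diagonal correction leaves the
  sum of squares.\<close>

lemma VWWI_tree:
  "VWWI tree = 1 / 2 * (\<Sum>u = 1..n. \<Sum>v = 1..n. \<mu> u * \<mu> v * \<bar>real (pos u) - real (pos v)\<bar>)
     + (\<Sum>i = 1..n. \<mu> i) * (\<Sum>i = q + 1..n. \<mu> i) - (\<Sum>i = q + 1..n. (\<mu> i)\<^sup>2)"
proof -
  let ?V = "{1..n}" and ?h = "\<lambda>u. real (height u)"
  have hops: "real (hops u v) = \<bar>real (pos u) - real (pos v)\<bar> + ?h u + ?h v - (if v = u then 2 * ?h u else 0)" for u v
    by (auto simp: hops_def)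
  have H: "(\<Sum>u\<in>?V. F u * ?h u) = (\<Sum>i = q + 1..n. F i)" for F :: "nat \<Rightarrow> real"
    using q by (intro sum.mono_neutral_cong_right) (auto simp: height_def)
  have "(\<Sum>u\<in>?V. \<Sum>v\<in>?V. \<mu> u * \<mu> v * real (hops u v)) =
     (\<Sum>u\<in>?V. \<Sum>v\<in>?V. \<mu> u * \<mu> v * \<bar>real (pos u) - real (pos v)\<bar> + (\<mu> u * ?h u) * \<mu> v + \<mu> u * (\<mu> v * ?h v)
        - (if v = u then 2 * ((\<mu> u)\<^sup>2 * ?h u) else 0))"
    unfolding hops by (intro sum.cong refl) (auto simp: algebra_simps power2_eq_square)
  also have "\<dots> = (\<Sum>u\<in>?V. \<Sum>v\<in>?V. \<mu> u * \<mu> v * \<bar>real (pos u) - real (pos v)\<bar>)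
      + (\<Sum>u\<in>?V. \<mu> u * ?h u) * (\<Sum>v\<in>?V. \<mu> v) + (\<Sum>u\<in>?V. \<mu> u) * (\<Sum>v\<in>?V. \<mu> v * ?h v)
      - 2 * (\<Sum>u\<in>?V. (\<mu> u)\<^sup>2 * ?h u)"
    by (simp add: sum.distrib sum_subtractf flip: sum_distrib_left sum_distrib_right)
  finally show ?thesis
    unfolding VWWI_def H by (simp add: tree_dist algebra_simps)
qed

end

section \<open>The symmetric weight distribution\<close>

text \<open>Symmetry folds the square onto \<open>l \<le> k\<close>, where the minimum is
  \<open>l\<close> and off-diagonal terms count twice.\<close>

lemma double_sum_min:
  fixes M :: "nat \<Rightarrow> real"
  shows "(\<Sum>k = 1..m. \<Sum>l = 1..m. M k * M l * real (min k l)) =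
    (\<Sum>k = 1..m. M k * (real k * M k + 2 * (\<Sum>l = 1..<k. real l * M l)))"
proof (induction m)
  case (Suc m)
  have "(\<Sum>k = 1..Suc m. \<Sum>l = 1..Suc m. M k * M l * real (min k l)) =
     (\<Sum>k = 1..m. (\<Sum>l = 1..m. M k * M l * real (min k l)) + M k * M (Suc m) * real k)
     + (\<Sum>l = 1..m. M (Suc m) * M l * real l) + M (Suc m) * M (Suc m) * real (Suc m)"
    by (simp add: algebra_simps)
  also have "\<dots> = (\<Sum>k = 1..m. \<Sum>l = 1..m. M k * M l * real (min k l))
     + M (Suc m) * (real (Suc m) * M (Suc m) + 2 * (\<Sum>l = 1..<Suc m. real l * M l))"
    by (simp add: sum.distrib sum_distrib_left sum_distrib_right algebra_simps
        atLeastLessThanSuc_atLeastAtMost del: of_nat_Suc)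
  finally show ?case using Suc by simp
qed simp

text \<open>
  The hypothesis says that the masses \<open>\<mu> u\<close>, placed at \<open>p u\<close>, amount to two masses \<open>M k\<close> at
  the mirror positions \<open>k\<close> and \<open>q + 1 - k\<close> for each \<open>k \<le> m\<close>; for odd \<open>q\<close> and \<open>k = m\<close> the two
  positions coincide.
\<close>

lemma symmetric_distance_sum:
  fixes M \<mu> :: "nat \<Rightarrow> real" and p :: "nat \<Rightarrow> nat"
  assumes dist: "\<And>g :: nat \<Rightarrow> real.
      (\<Sum>u\<in>V. \<mu> u * g (p u)) = (\<Sum>k = 1..m. M k * (g k + g (q + 1 - k)))"
    and m: "2 * m \<le> q + 1"
  shows "1 / 2 * (\<Sum>u\<in>V. \<Sum>v\<in>V. \<mu> u * \<mu> v * \<bar>real (p u) - real (p v)\<bar>) =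
    (real q + 1) / 4 * (\<Sum>u\<in>V. \<mu> u)\<^sup>2
    - (\<Sum>k = 1..m. 2 * M k * (real k * M k + 2 * (\<Sum>l = 1..<k. real l * M l)))"
proof -
  \<comment> \<open>The weighted distance from \<open>x\<close> to the whole distribution;
    \<open>dist\<close> is applied once for each summation variable.\<close>
  define g where "g x = (\<Sum>l = 1..m. M l * (\<bar>real x - real l\<bar> + \<bar>real x - real (q + 1 - l)\<bar>))" for x
  have tot: "(\<Sum>u\<in>V. \<mu> u) = 2 * (\<Sum>k = 1..m. M k)"
    using dist[of "\<lambda>_. 1"] by (simp add: sum_distrib_left mult.commute)
  have "(\<Sum>u\<in>V. \<Sum>v\<in>V. \<mu> u * \<mu> v * \<bar>real (p u) - real (p v)\<bar>) = (\<Sum>u\<in>V. \<mu> u * g (p u))"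
    using dist[of "\<lambda>y. \<bar>real x - real y\<bar>" for x]
    by (simp add: g_def mult.assoc flip: sum_distrib_left)
  also have "\<dots> = (\<Sum>k = 1..m. M k * (g k + g (q + 1 - k)))" by (rule dist)
  also have "\<dots> = (\<Sum>k = 1..m. \<Sum>l = 1..m. M k * M l * (2 * (real q + 1) - 4 * real (min k l)))"
    unfolding g_def sum.distrib[symmetric] sum_distrib_left
  proof (intro sum.cong refl)
    fix k l assume "k \<in> {1..m}" "l \<in> {1..m}"
    \<comment> \<open>Since \<open>2 * m \<le> q + 1\<close>, both \<open>k\<close> and
      \<open>l\<close> lie left of, or at, both mirror positions. Thus \<open>|k - l|\<close> and
      \<open>q + 1 - k - l\<close> each occur twice.\<close>
    then have "\<bar>real k - real l\<bar> + \<bar>real k - real (q + 1 - l)\<bar>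
        + (\<bar>real (q + 1 - k) - real l\<bar> + \<bar>real (q + 1 - k) - real (q + 1 - l)\<bar>)
        = 2 * (real q + 1) - 4 * real (min k l)"
      using m by (auto simp: min_def of_nat_diff)
    then show "M k * (M l * (\<bar>real k - real l\<bar> + \<bar>real k - real (q + 1 - l)\<bar>)
        + M l * (\<bar>real (q + 1 - k) - real l\<bar> + \<bar>real (q + 1 - k) - real (q + 1 - l)\<bar>))
        = M k * M l * (2 * (real q + 1) - 4 * real (min k l))"
      by (simp only: mult.assoc flip: distrib_left)
  qed
  also have "\<dots> = 2 * (real q + 1) * (\<Sum>k = 1..m. M k)\<^sup>2
      - 4 * (\<Sum>k = 1..m. \<Sum>l = 1..m. M k * M l * real (min k l))"
    by (simp add: power2_eq_square sum_product sum_distrib_left right_diff_distrib sum_subtractf ac_simps)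
  finally show ?thesis
    unfolding double_sum_min tot mult.assoc[of 2] sum_distrib_left[of 2, symmetric]
    by (simp add: power2_eq_square algebra_simps)
qed

section \<open>Distributing the leaves\<close>

lemma sum_pairs:
  fixes F :: "nat \<Rightarrow> 'a :: comm_monoid_add"
  shows "(\<Sum>i = 1..2 * h. F i) = (\<Sum>k = 1..h. F (2 * k - 1) + F (2 * k))"
  by (induction h) (simp_all add: ac_simps)

lemma sum_blocks:
  fixes E :: "nat \<Rightarrow> nat" and F :: "nat \<Rightarrow> 'a :: comm_monoid_add"
  assumes "mono E" "E 0 = 0"
  shows "(\<Sum>t = 1..E h. F t) = (\<Sum>k = 1..h. \<Sum>t = E (k - 1) + 1..E k. F t)"
proof (induction h)
  case (Suc h)
  have "E h \<le> E (Suc h)" using assms(1) by (simp add: monoD)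
  then have "{1..E (Suc h)} = {1..E h} \<union> {E h + 1..E (Suc h)}" by auto
  then have "(\<Sum>t = 1..E (Suc h). F t) = (\<Sum>t = 1..E h. F t) + (\<Sum>t = E h + 1..E (Suc h). F t)"
    by (simp add: sum.union_disjoint)
  then show ?case using Suc by simp
qed (simp add: assms(2))

lemma Least_block:
  fixes E :: "nat \<Rightarrow> nat"
  assumes "mono E" "1 \<le> k" "E (k - 1) < t" "t \<le> E k"
  shows "(LEAST k. t \<le> E k) = k"
proof (rule Least_equality)
  fix y assume "t \<le> E y"
  show "k \<le> y"
  proof (rule ccontr)
    assume "\<not> k \<le> y"
    then have "E y \<le> E (k - 1)" using assms(1) by (simp add: monoD)
    then show False using assms \<open>t \<le> E y\<close> by simp
  qed
qed fact

text \<open>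
  The \<open>t\<close>-th pair of leaves goes to the pair of spine vertices \<open>2k - 1, 2k\<close> with
  \<open>E (k - 1) < t \<le> E k\<close>, and the leaves beyond the last of these pairs go to the middle \<open>q\<close>.
\<close>

definition attach :: "nat \<Rightarrow> (nat \<Rightarrow> nat) \<Rightarrow> nat \<Rightarrow> nat \<Rightarrow> nat" where
  "attach q E h x = (if x \<le> q + 2 * E h
     then 2 * (LEAST k. (x - q + 1) div 2 \<le> E k) - (x - q) mod 2 else q)"

text \<open>\<open>G\<close> sees a leaf together with its neighbour, so one decomposition serves
  both the degree count and the weight sums.\<close>

lemma sum_attach:
  fixes E :: "nat \<Rightarrow> nat" and G :: "nat \<Rightarrow> nat \<Rightarrow> 'a :: comm_monoid_add"
  assumes E: "mono E" "E 0 = 0" and n: "q + 2 * E h \<le> n"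
  shows "(\<Sum>x = q + 1..n. G x (attach q E h x)) =
    (\<Sum>k = 1..h. \<Sum>t = E (k - 1) + 1..E k. G (q + 2 * t - 1) (2 * k - 1) + G (q + 2 * t) (2 * k))
    + (\<Sum>x = q + 2 * E h + 1..n. G x q)"
proof -
  let ?G = "\<lambda>x. G x (attach q E h x)"
  have "{q + 1..n} = {q + 1..q + 2 * E h} \<union> {q + 2 * E h + 1..n}" using n by auto
  then have "sum ?G {q + 1..n} = sum ?G {q + 1..q + 2 * E h} + sum ?G {q + 2 * E h + 1..n}"
    by (simp add: sum.union_disjoint)
  moreover have "sum ?G {q + 2 * E h + 1..n} = (\<Sum>x = q + 2 * E h + 1..n. G x q)"
    by (intro sum.cong) (auto simp: attach_def)
  moreover have "sum ?G {q + 1..q + 2 * E h} = (\<Sum>i = 1..2 * E h. ?G (q + i))"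
    using sum.shift_bounds_cl_nat_ivl[of ?G 1 q "2 * E h"] by (simp add: add.commute)
  moreover have "\<dots> = (\<Sum>t = 1..E h. ?G (q + (2 * t - 1)) + ?G (q + 2 * t))"
    by (rule sum_pairs)
  moreover have "\<dots> = (\<Sum>k = 1..h. \<Sum>t = E (k - 1) + 1..E k. ?G (q + (2 * t - 1)) + ?G (q + 2 * t))"
    by (rule sum_blocks[OF E])
  moreover have "\<dots> = (\<Sum>k = 1..h. \<Sum>t = E (k - 1) + 1..E k.
      G (q + 2 * t - 1) (2 * k - 1) + G (q + 2 * t) (2 * k))"
  proof (intro sum.cong refl)
    fix k t assume k: "k \<in> {1..h}" and t: "t \<in> {E (k - 1) + 1..E k}"
    have "E k \<le> E h" using k E(1) by (simp add: monoD)
    moreover have "(LEAST k. t \<le> E k) = k" using Least_block[OF E(1)] k t by auto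
    \<comment> \<open>Both leaves of the pair have pair number \<open>t\<close>; parity sends the
      first to \<open>2 * k - 1\<close> and the second to \<open>2 * k\<close>.\<close>
    moreover have "(2 * t - 1) mod 2 = 1" "(2 * t) mod 2 = 0" "(2 * t - 1 + 1) div 2 = t"
      "(2 * t + 1) div 2 = t" using t by (auto simp: mod_eq_self_iff_div_eq_0 mod2_eq_if)
    ultimately have "attach q E h (q + (2 * t - 1)) = 2 * k - 1" "attach q E h (q + 2 * t) = 2 * k"
      using t unfolding attach_def by auto
    then show "?G (q + (2 * t - 1)) + ?G (q + 2 * t) = G (q + 2 * t - 1) (2 * k - 1) + G (q + 2 * t) (2 * k)"
      using t by simp
  qed
  ultimately show ?thesis by simp
qed

lemma attach_in:
  assumes "E 0 = 0" "x \<in> {q + 1..n}" "2 * h \<le> q" "1 \<le> q"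
  shows "attach q E h x \<in> {1..q}"
proof (cases "x \<le> q + 2 * E h")
  case True
  let ?P = "\<lambda>k. (x - q + 1) div 2 \<le> E k"
  have "?P h" using True by auto
  then have "?P (Least ?P)" "Least ?P \<le> h" by (rule LeastI, rule Least_le)
  \<comment> \<open>Pair numbers start at 1 while \<open>E 0 = 0\<close>, so block 0 is empty and
    the target is at least 1.\<close>
  moreover have "Least ?P \<noteq> 0"
  proof
    assume "Least ?P = 0"
    with \<open>?P (Least ?P)\<close> have "(x - q + 1) div 2 \<le> E 0" by simp
    then show False using assms by auto
  qed
  moreover have "(x - q) mod 2 \<le> 1" by simp
  ultimately show ?thesis using True assms unfolding attach_def by simp linarith
qed (use assms in \<open>simp add: attach_def\<close>)

section \<open>Choice of the caterpillar, its degrees and its index\<close>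

theorem theorem2:
  fixes n q :: nat and d :: "nat \<Rightarrow> nat" and \<mu> :: "nat \<Rightarrow> real"
  assumes "4 \<le> q" and "q < n"
    and "\<And>i. i \<in> {1..n} \<Longrightarrow> 0 < d i"
    and "\<And>i j. 1 \<le> i \<Longrightarrow> i \<le> j \<Longrightarrow> j \<le> n \<Longrightarrow> d j \<le> d i"
    and "\<And>i. i \<in> {1..q} \<Longrightarrow> 2 \<le> d i"
    and "\<And>i. i \<in> {q + 1..n} \<Longrightarrow> d i = 1"
    and "(\<Sum>i = 1..n. d i) = 2 * (n - 1)"
    and "\<And>i. i \<in> {1..n} \<Longrightarrow> 0 \<le> \<mu> i"
    and "\<And>i j. 1 \<le> i \<Longrightarrow> i < j \<Longrightarrow> j \<le> n \<Longrightarrow> d i = d j \<Longrightarrow> \<mu> j \<le> \<mu> i"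
    and "monotone_in n \<mu> d"
    and "\<And>i. i \<in> {1..q div 2} \<Longrightarrow> \<mu> (2 * i - 1) = \<mu> (2 * i) \<and> d (2 * i - 1) = d (2 * i)"
    and "\<And>i. i \<in> {1..(n - q) div 2} \<Longrightarrow> \<mu> (q + 2 * i - 1) = \<mu> (q + 2 * i)"
  shows "\<exists>T :: nat weighted_graph. T \<in> WT n \<mu> d \<and> VWWI T = UB n q \<mu> d"
proof -
  define h where "h = q div 2"
  \<comment> \<open>The number of leaf pairs used by the first \<open>k\<close> spine pairs, half of
    \<open>D d k\<close>. The extra 1 is for the spine ends 1 and 2, which have only one spine
    neighbour; \<open>r\<close> counts the leaves at the middle when \<open>q\<close> is
    odd.\<close>
  define E where "E k = (if k = 0 then 0 else 1 + (\<Sum>i = 1..k. d (2 * i) - 2))" for k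
  define r where "r = (if odd q then d q - 2 else 0)"
  have h: "2 \<le> h" "2 * h \<le> q" "q = (if odd q then 2 * h + 1 else 2 * h)"
    using assms(1) by (auto simp: h_def)
  have E: "mono E" "E 0 = 0"
  proof -
    have "E k \<le> E (Suc k)" for k by (simp add: E_def)
    then show "mono E" by (simp add: mono_iff_le_Suc)
  qed (simp add: E_def)
  have pair: "\<mu> (2 * k - 1) = \<mu> (2 * k)" "d (2 * k - 1) = d (2 * k)" "2 \<le> d (2 * k)" if "k \<in> {1..h}" for k
    using assms(11)[of k] assms(5)[of "2 * k"] that h by (auto simp: h_def)
  have sum_spine: "(\<Sum>i = 1..2 * k. d i - 2) = 2 * (\<Sum>i = 1..k. d (2 * i) - 2)" if "k \<le> h" for k
    unfolding sum_pairs sum_distrib_left using that pair by (intro sum.cong) auto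
  have D: "D d k = 2 * E k" if "k \<le> h" for k
  proof (cases "k = 1")
    case True
    then show ?thesis using pair[of 1] h by (simp add: D_def E_def)
  next
    case False
    then show ?thesis using sum_spine[OF that] by (simp add: D_def E_def)
  qed
  \<comment> \<open>The degree sum fixes the number of leaves: the pairs and the \<open>r\<close>
    leaves at the middle exhaust them.\<close>
  have n: "n = q + 2 * E h + r"
  proof -
    have "{1..n} = {1..q} \<union> {q + 1..n}" using assms(2) by auto
    then have "(\<Sum>i = 1..n. d i) = (\<Sum>i = 1..q. d i) + (\<Sum>i = q + 1..n. d i)"
      by (simp add: sum.union_disjoint)
    also have "(\<Sum>i = q + 1..n. d i) = n - q" using assms(6) by simp
    also have "(\<Sum>i = 1..q. d i) = (\<Sum>i = 1..q. (d i - 2) + 2)"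
      using le_add_diff_inverse2[OF assms(5)] by (intro sum.cong) auto
    also have "\<dots> = (\<Sum>i = 1..q. d i - 2) + 2 * q" by (simp add: sum.distrib del: add_2_eq_Suc')
    also have "(\<Sum>i = 1..q. d i - 2) = (\<Sum>i = 1..2 * h. d i - 2) + r"
      using h(3) by (cases "odd q") (simp_all add: r_def)
    finally show ?thesis using assms(7,2) sum_spine[of h] h(1) by (simp add: E_def)
  qed
  interpret caterpillar n q "attach q E h" \<mu>
    using assms(1,2) attach_in[where E = E, OF E(2)] h by unfold_locales auto
  have "q + 2 * E h \<le> n" using n by simp
  note leaves = sum_attach[OF E this]
  have deg: "degree tree v = d v" if v: "v \<in> {1..n}" for v
  proof (cases "v \<le> q")
    case False
    then have "{x \<in> {q + 1..n}. attach q E h x = v} = {}"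
      using attach_in[where E = E, OF E(2), of _ q n h] h assms(1) by fastforce
    then show ?thesis using False v degree_tree[OF v] assms(6)[of v] by simp
  next
    case True
    have "card {x \<in> {q + 1..n}. attach q E h x = v} =
        (\<Sum>x = q + 1..n. if attach q E h x = v then 1 else 0)"
      by (simp add: sum.If_cases Int_def)
    also have "\<dots> = (\<Sum>k = 1..h. (E k - E (k - 1)) * ((if 2 * k - 1 = v then 1 else 0) + (if 2 * k = v then 1 else 0)))
      + (if q = v then r else 0)"
      unfolding leaves[of "\<lambda>x i. if i = v then 1 else 0"] using n by simp
    \<comment> \<open>The vertex \<open>v\<close> belongs to the spine pair with number
      \<open>(v + 1) div 2\<close>.\<close>
    also have "\<dots> = (\<Sum>k = 1..h. if k = (v + 1) div 2 then E k - E (k - 1) else 0) + (if q = v then r else 0)"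
      by (intro arg_cong2[where f = "(+)"] sum.cong refl) (auto elim!: oddE evenE)
    also have "\<dots> = (if v \<le> 2 * h then E ((v + 1) div 2) - E ((v + 1) div 2 - 1) else 0) + (if q = v then r else 0)"
      using v by (auto simp: sum.delta)
    also have "\<dots> = (if v \<le> 2 then d v - 1 else d v - 2)"
    proof (cases "v \<le> 2 * h")
      case le: True
      define k where "k = (v + 1) div 2"
      have k: "k \<in> {1..h}" "v = 2 * k \<or> v = 2 * k - 1" using le v by (auto simp: k_def)
      have "E k - E (k - 1) = (if k = 1 then d (2 * k) - 1 else d (2 * k) - 2)"
        using k pair[OF k(1)] by (cases k) (auto simp: E_def numeral_2_eq_2)
      moreover have "v = q \<Longrightarrow> r = 0" using le h(3) by (auto simp: r_def)
      moreover have "d v = d (2 * k)" using k pair[OF k(1)] by auto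
      moreover have "k = 1 \<longleftrightarrow> v \<le> 2" using k by auto
      ultimately show ?thesis using le unfolding k_def[symmetric] by auto
    next
      case False
      then have "v = q" "odd q" using True h(3) by (auto split: if_splits)
      then show ?thesis using False assms(1) by (simp add: r_def)
    qed
    finally show ?thesis using degree_tree[OF v] True assms(1) assms(5)[of v] v by auto
  qed
  have "tree \<in> WT n \<mu> d"
    using is_tree_tree deg by (auto simp: WT_def intro!: exI[of _ id])
  moreover have "VWWI tree = UB n q \<mu> d"
  proof -
    define m where "m = (q + 1) div 2"
    have m: "m = (if odd q then h + 1 else h)" by (auto simp: m_def h_def elim!: oddE evenE)
    have ceil: "nat \<lceil>real q / 2\<rceil> = m"
      unfolding m_def by (cases "even q") (auto elim!: oddE evenE simp: ceiling_eq_iff intro!: nat_eq_iff[THEN iffD2])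
    \<comment> \<open>The mirror symmetry required by \<open>symmetric_distance_sum\<close>, with an
      arbitrary test function \<open>g\<close> on positions.\<close>
    have "(\<Sum>u = 1..n. \<mu> u * g (pos u)) = (\<Sum>k = 1..m. M n q \<mu> d k * (g k + g (q + 1 - k)))"
      for g :: "nat \<Rightarrow> real"
    proof -
      have mid: "spine_pos q = h + 1" if "odd q" using that by (auto simp: spine_pos_def h_def elim!: oddE)
      let ?mid = "if odd q then (\<mu> q + (\<Sum>x = q + 2 * E h + 1..n. \<mu> x)) * g (h + 1) else 0"
      have "{1..n} = {1..q} \<union> {q + 1..n}" using assms(2) by auto
      then have "(\<Sum>u = 1..n. \<mu> u * g (pos u)) =
          (\<Sum>u = 1..q. \<mu> u * g (pos u)) + (\<Sum>u = q + 1..n. \<mu> u * g (pos u))"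
        by (simp add: sum.union_disjoint)
      also have "(\<Sum>u = 1..q. \<mu> u * g (pos u)) = (\<Sum>u = 1..q. \<mu> u * g (spine_pos u))"
        by (simp add: pos_def)
      also have "\<dots> = (\<Sum>u = 1..2 * h. \<mu> u * g (spine_pos u)) + (if odd q then \<mu> q * g (h + 1) else 0)"
      proof (cases "odd q")
        case True
        then have "{1..q} = insert q {1..2 * h}" "q \<notin> {1..2 * h}" using h(3) by auto
        then show ?thesis using True mid by simp
      next
        case False
        then have "2 * h = q" using h(3) by simp
        then show ?thesis using False by simp
      qed
      also have "(\<Sum>u = 1..2 * h. \<mu> u * g (spine_pos u)) = (\<Sum>k = 1..h. \<mu> (2 * k) * (g k + g (q + 1 - k)))"
        unfolding sum_pairs using pair(1)
        by (intro sum.cong refl) (simp add: spine_pos_def distrib_left)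
      also have "(\<Sum>u = q + 1..n. \<mu> u * g (pos u)) =
          (\<Sum>u = q + 1..n. \<mu> u * g (spine_pos (attach q E h u)))"
        by (intro sum.cong) (auto simp: pos_def)
      also have "\<dots> = (\<Sum>k = 1..h. (\<Sum>t = E (k - 1) + 1..E k. \<mu> (q + 2 * t)) * (g k + g (q + 1 - k)))
          + (if odd q then (\<Sum>x = q + 2 * E h + 1..n. \<mu> x) * g (h + 1) else 0)"
      proof -
        have "\<mu> (q + 2 * t - 1) * g (spine_pos (2 * k - 1)) + \<mu> (q + 2 * t) * g (spine_pos (2 * k))
            = \<mu> (q + 2 * t) * (g k + g (q + 1 - k))"
          if "k \<in> {1..h}" "t \<in> {E (k - 1) + 1..E k}" for k t
        proof -
          have "E k \<le> E h" using that E(1) by (simp add: monoD)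
          then have "t \<in> {1..(n - q) div 2}" using that n by auto
          from assms(12)[OF this] that show ?thesis by (simp add: spine_pos_def distrib_left)
        qed
        \<comment> \<open>For even \<open>q\<close> no leaves remain, since
          \<open>r = 0\<close>.\<close>
        moreover have "(\<Sum>x = q + 2 * E h + 1..n. \<mu> x * g (spine_pos q)) =
          (if odd q then (\<Sum>x = q + 2 * E h + 1..n. \<mu> x) * g (h + 1) else 0)"
          using mid n by (cases "odd q") (simp_all add: r_def sum_distrib_right)
        ultimately show ?thesis
          unfolding leaves[of "\<lambda>x i. \<mu> x * g (spine_pos i)"] sum_distrib_right by simp
      qed
      finally have "(\<Sum>u = 1..n. \<mu> u * g (pos u)) =
          (\<Sum>k = 1..h. (\<mu> (2 * k) + (\<Sum>t = E (k - 1) + 1..E k. \<mu> (q + 2 * t))) * (g k + g (q + 1 - k))) + ?mid"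
        by (simp add: distrib_right sum.distrib)
      also have "(\<Sum>k = 1..h. (\<mu> (2 * k) + (\<Sum>t = E (k - 1) + 1..E k. \<mu> (q + 2 * t))) * (g k + g (q + 1 - k)))
          = (\<Sum>k = 1..h. M n q \<mu> d k * (g k + g (q + 1 - k)))"
      proof (intro sum.cong refl arg_cong2[where f = "(*)"])
        fix k assume k: "k \<in> {1..h}"
        have "E k \<le> E h" using k E(1) by (simp add: monoD)
        have "(\<Sum>i = 1 + D d (k - 1)..D d k. \<mu> (q + i)) = (\<Sum>i = 2 * E (k - 1) + 1..2 * E k. \<mu> (q + i))"
          using k D[of k] D[of "k - 1"] by auto
        also have "\<dots> = (\<Sum>t = E (k - 1) + 1..E k. \<mu> (q + (2 * t - 1)) + \<mu> (q + 2 * t))"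
        proof -
          have "E (k - 1) \<le> E k" using E(1) by (simp add: monoD)
          then have *: "{1..2 * E k} = {1..2 * E (k - 1)} \<union> {2 * E (k - 1) + 1..2 * E k}"
            "{1..E k} = {1..E (k - 1)} \<union> {E (k - 1) + 1..E k}" by auto
          show ?thesis
            using sum_pairs[of "\<lambda>i. \<mu> (q + i)" "E k"] sum_pairs[of "\<lambda>i. \<mu> (q + i)" "E (k - 1)"]
            unfolding * by (simp add: sum.union_disjoint)
        qed
        also have "\<dots> = (\<Sum>t = E (k - 1) + 1..E k. 2 * \<mu> (q + 2 * t))"
        proof (intro sum.cong refl)
          fix t assume t: "t \<in> {E (k - 1) + 1..E k}"
          then have "t \<in> {1..(n - q) div 2}" using \<open>E k \<le> E h\<close> n by auto
          from assms(12)[OF this] t show "\<mu> (q + (2 * t - 1)) + \<mu> (q + 2 * t) = 2 * \<mu> (q + 2 * t)" by simp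
        qed
        \<comment> \<open>Equal weights within pairs cancel the factor \<open>1 / 2\<close> in
          \<open>M\<close>.\<close>
        finally show "\<mu> (2 * k) + (\<Sum>t = E (k - 1) + 1..E k. \<mu> (q + 2 * t)) = M n q \<mu> d k"
          using k pair[OF k] by (simp add: M_def h_def flip: sum_distrib_left)
      qed
      also have "\<dots> + ?mid = (\<Sum>k = 1..m. M n q \<mu> d k * (g k + g (q + 1 - k)))"
      proof (cases "odd q")
        case True
        have "(\<Sum>x = q + 2 * E h + 1..n. \<mu> x) = (\<Sum>i<d q - 2. \<mu> (n - i))"
          using n True by (intro sum.reindex_bij_witness[of _ "\<lambda>i. n - i" "\<lambda>x. n - x"]) (auto simp: r_def)
        \<comment> \<open>The centre is its own mirror image, so its term counts
          \<open>g (h + 1)\<close> twice, matching the factor \<open>1 / 2\<close> in the last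
          \<open>M\<close>.\<close>
        moreover have "q + 1 - (h + 1) = h + 1" "\<not> h + 1 \<le> q div 2" using True by (auto simp: h_def elim!: oddE)
        ultimately show ?thesis using True unfolding m by (simp add: M_def)
      qed (simp add: m)
      finally show ?thesis .
    qed
    from symmetric_distance_sum[OF this] have
      "1 / 2 * (\<Sum>u = 1..n. \<Sum>v = 1..n. \<mu> u * \<mu> v * \<bar>real (pos u) - real (pos v)\<bar>) =
        (real q + 1) / 4 * (\<Sum>u = 1..n. \<mu> u)\<^sup>2
        - (\<Sum>k = 1..m. 2 * M n q \<mu> d k * (real k * M n q \<mu> d k + 2 * (\<Sum>l = 1..<k. real l * M n q \<mu> d l)))"
      by (simp add: m_def)
    then show ?thesis
      unfolding VWWI_tree UB_def Let_def ceil by (simp add: power2_eq_square algebra_simps)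
  qed
  ultimately show ?thesis by blast
qed

end
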